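(* Let $P\subset\mathbb{R}^d$ be a set of $n$ points, let $\gamma\in(0,1)$, and let $0<\epsilon,\delta,\mu<1$. Run the randomized tree construction described in the context on $(P,\gamma,\epsilon,\delta,\mu,h)$ with $h=\lceil 2/\epsilon\rceil+1$, and let $\mathbb{H}$ be the resulting tree. Then with probability at least $(1-\mu)(1-\gamma)$ there exists at least one node $v$ of $\mathbb{H}$ whose attached point $c_v$ yields an $(\epsilon,\delta)$-approximation for the problem of MEB with outliers on the instance $(P,\gamma)$; that is, there is a ball centered at $c_v$ of radius at most $(1+\epsilon)r_{\text{opt}}$ that covers at least $(1-(1+\delta)\gamma)n$ points of $P$.
   Context: For a finite set $Q\subset\mathbb{R}^d$, $MEB(Q)$ (minimum enclosing ball) is the closed Euclidean ball of smallest radius covering all points of $Q$. MEB with outliers: given a set $P$ of $n$ points in $\mathbb{R}^d$ and $\gamma\in(0,1)$, find the smallest ball covering at least $(1-\gamma)n$ points of $P$. $P_{\text{opt}}$ denotes a (fixed) subset $P'\subset P$ with $|P'|\ge(1-\gamma)n$ minimizing the radius of $MEB(P')$, and $r_{\text{opt}}$ is the radius of $MEB(P_{\text{opt}})$. For $0<\epsilon,\delta<1$, an $(\epsilon,\delta)$-approximation is a ball that covers at least $(1-(1+\delta)\gamma)n$ points of $P$ and has radius at most $(1+\epsilon)r_{\text{opt}}$; a point is said to be (or yield) an $(\epsilon,\delta)$-approximation if some ball centered at it is one. Tree construction (input: $P$, $\gamma$, $0<\epsilon,\delta,\mu<1$, $h\in\mathbb{Z}^+$). Each node of the tree is associated with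 a point of $P$ (node and point are denoted by the same symbol). The root $r$ is a uniformly random point of $P$ and has height $1$; a child of a node of height $i$ has height $i+1$. For every node $v$, let $\mathcal{P}^r_v$ be the set of points along the path from the root $r$ to $v$ (both included), and let $c_v$, the attached point of $v$, be the center of $MEB(\mathcal{P}^r_v)$. Nodes of height $h$ are leaves. Every node $v$ of height less than $h$ is grown as follows: let $k=(1+\delta)\gamma n$ and let $P_v\subset P$ consist of the $k$ points of $P$ with the largest distances to $c_v$ (ties broken arbitrarily); take a fresh uniformly random sample $S_v$ of size $(1+\frac1\delta)\ln\frac h\mu$ from $P_v$, and make each sampled point a child of $v$. Conventions: $k=(1+\delta)\gamma n$ is an integer and $(1+\delta)\gamma<1$; the sample size is rounded up to an integer; samples are drawn independently with replacement, independently of all other random choices. *)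

theory Defs
  imports "HOL-Probability.Probability"
begin

definition is_MEB :: "'a::euclidean_space set \<Rightarrow> 'a \<Rightarrow> real \<Rightarrow> bool" where
  "is_MEB Q c r \<longleftrightarrow> 0 \<le> r \<and> Q \<subseteq> cball c r \<and>
     (\<forall>c' r'. 0 \<le> r' \<and> Q \<subseteq> cball c' r' \<longrightarrow> r \<le> r')"

text \<open>Centre and radius are unique for nonempty bounded sets, in particular for
  nonempty finite ones.\<close>

definition meb_center :: "'a::euclidean_space set \<Rightarrow> 'a" where
  "meb_center Q = (THE c. \<exists>r. is_MEB Q c r)"

definition meb_radius :: "'a::euclidean_space set \<Rightarrow> real" where
  "meb_radius Q = (THE r. \<exists>c. is_MEB Q c r)"

definition is_outlier_opt :: "'a::euclidean_space set \<Rightarrow> real \<Rightarrow> 'a set \<Rightarrow> bool" where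
  "is_outlier_opt P \<gamma> Q \<longleftrightarrow> Q \<subseteq> P \<and> real (card Q) \<ge> (1 - \<gamma>) * real (card P) \<and>
     (\<forall>Q'. Q' \<subseteq> P \<and> real (card Q') \<ge> (1 - \<gamma>) * real (card P)
        \<longrightarrow> meb_radius Q \<le> meb_radius Q')"

text \<open>The point \<open>c\<close> yields an \<open>(\<epsilon>, \<delta>)\<close>-approximation, where \<open>r_opt\<close> is the optimal radius.\<close>

definition yields_approx ::
    "'a::euclidean_space set \<Rightarrow> real \<Rightarrow> real \<Rightarrow> real \<Rightarrow> real \<Rightarrow> 'a \<Rightarrow> bool" where
  "yields_approx P \<gamma> r_opt \<epsilon> \<delta> c \<longleftrightarrow>
     (\<exists>\<rho>. 0 \<le> \<rho> \<and> \<rho> \<le> (1 + \<epsilon>) * r_opt \<and>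
          real (card (P \<inter> cball c \<rho>)) \<ge> (1 - (1 + \<delta>) * \<gamma>) * real (card P))"

definition is_farthest :: "'a::euclidean_space set \<Rightarrow> nat \<Rightarrow> 'a \<Rightarrow> 'a set \<Rightarrow> bool" where
  "is_farthest P k c Q \<longleftrightarrow> Q \<subseteq> P \<and> card Q = k \<and>
     (\<forall>x\<in>Q. \<forall>y\<in>P - Q. dist c y \<le> dist c x)"

text \<open>Finite ordered trees. Samples are drawn with replacement, so distinct nodes (even
  siblings) may carry the same point.\<close>

datatype 'a rtree = RNode 'a "'a rtree list"

text \<open>One list for every node: the points on the path from the root to that node, both included.\<close>

primrec node_paths :: "'a rtree \<Rightarrow> 'a list set" where
  "node_paths (RNode v ts) = (#) v ` insert [] (\<Union> (set (map node_paths ts)))"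

primrec indep_list_pmf :: "'a pmf list \<Rightarrow> 'a list pmf" where
  "indep_list_pmf [] = return_pmf []"
| "indep_list_pmf (p # ps) =
     bind_pmf p (\<lambda>x. bind_pmf (indep_list_pmf ps) (\<lambda>xs. return_pmf (x # xs)))"

text \<open>\<open>grow_tree far s m a xs\<close> is the law of the subtree rooted at a node \<open>v\<close> below which \<open>m\<close>
  further levels are grown. Here \<open>xs\<close> lists the points on the path from the root to \<open>v\<close>,
  and \<open>a\<close> is the position of \<open>v\<close> in the tree (the child indices leading from the root to \<open>v\<close>).
  The set \<open>far a xs\<close> plays the role of \<open>P\<^sub>v\<close>. Since it may depend on the position as well as
  on the path, ties can be broken differently even at nodes with the same points on their paths.
  The number \<open>s\<close> is the sample size.\<close>

primrec grow_tree ::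
    "(nat list \<Rightarrow> 'a list \<Rightarrow> 'a set) \<Rightarrow> nat \<Rightarrow> nat \<Rightarrow> nat list \<Rightarrow> 'a list \<Rightarrow> 'a rtree pmf" where
  "grow_tree far s 0 a xs = return_pmf (RNode (last xs) [])"
| "grow_tree far s (Suc m) a xs =
     bind_pmf (replicate_pmf s (pmf_of_set (far a xs))) (\<lambda>S.
       bind_pmf (indep_list_pmf
           (map (\<lambda>i. grow_tree far s m (a @ [i]) (xs @ [S ! i])) [0..<length S])) (\<lambda>ts.
         return_pmf (RNode (last xs) ts)))"

definition sample_size :: "real \<Rightarrow> real \<Rightarrow> nat \<Rightarrow> nat" where
  "sample_size \<delta> \<mu> h = nat \<lceil>(1 + 1 / \<delta>) * ln (real h / \<mu>)\<rceil>"

text \<open>The root has height \<open>1\<close>, so \<open>h - 1\<close> levels are grown below it.\<close>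

definition random_tree ::
    "'a set \<Rightarrow> (nat list \<Rightarrow> 'a list \<Rightarrow> 'a set) \<Rightarrow> real \<Rightarrow> real \<Rightarrow> nat \<Rightarrow> 'a rtree pmf" where
  "random_tree P far \<delta> \<mu> h =
     bind_pmf (pmf_of_set P) (\<lambda>r. grow_tree far (sample_size \<delta> \<mu> h) (h - 1) [] [r])"

end

theory Submission
  imports Defs
begin

text \<open>
  Follow a root-to-leaf path all of whose points lie in the optimal set. A node \<open>v\<close> whose centre is
  not an approximation has all of \<open>P\<^sub>v\<close> outside the ball of radius \<open>(1 + \<epsilon>) r_opt\<close> about that
  centre, and at least a fraction \<open>\<delta> / (1 + \<delta>)\<close> of \<open>P\<^sub>v\<close> is optimal. So with probability at least
  \<open>1 - \<mu> / h\<close> some child of \<open>v\<close> is an optimal point that is far from the current centre.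
  As in the core-set argument of Badoiu and Clarkson, each such point forces the radius of the
  enclosing ball up: after \<open>i\<close> points it is at least \<open>(i - 1) / (i + 1) * (1 + \<epsilon>) r_opt\<close>. This would
  exceed \<open>r_opt\<close> once \<open>i > 1 + 2 / \<epsilon>\<close>.
\<close>

section \<open>Minimum enclosing balls\<close>

text \<open>By compactness. Enclosing balls, viewed as pairs of centre and radius, form a closed
  set. One of radius at most \<open>B0\<close> contains \<open>q\<close>, so its centre lies in
  \<open>cball q B0\<close>. Balls larger than \<open>B0\<close> cannot beat the one about
  \<open>q\<close>.\<close>

lemma ex_is_MEB:
  fixes Q :: "'a::euclidean_space set"
  assumes "bounded Q" "Q \<noteq> {}"
  shows "\<exists>c r. is_MEB Q c r"
proof -
  obtain q where q: "q \<in> Q" using assms by blast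
  obtain B0 where "\<And>x. x \<in> Q \<Longrightarrow> dist q x \<le> B0"
    using assms(1) bounded_any_center[of Q q] by blast
  then have QB: "Q \<subseteq> cball q B0" and B0: "0 \<le> B0"
    using q by (auto intro: order_trans[OF zero_le_dist])
  define A where "A = (cball q B0 \<times> {0..B0}) \<inter> (\<Inter>x\<in>Q. {z. dist (fst z) x \<le> snd z})"
  have "closed {z :: 'a \<times> real. dist (fst z) x \<le> snd z}" for x
    by (intro closed_Collect_le continuous_intros)
  then have "compact A"
    unfolding A_def by (intro compact_Int_closed compact_Times closed_INT) auto
  moreover have "(q, B0) \<in> A" using QB B0 by (auto simp: A_def)
  moreover have "continuous_on A snd" by (intro continuous_intros)
  ultimately obtain z where z: "z \<in> A" "\<And>w. w \<in> A \<Longrightarrow> snd z \<le> snd w"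
    using continuous_attains_inf[of A snd] by blast
  have "snd z \<le> r" if r: "0 \<le> r" "Q \<subseteq> cball c r" for c r
  proof (cases "r \<le> B0")
    case True
    moreover have "dist q c \<le> r" using r(2) q by (auto simp: dist_commute)
    ultimately have "(c, r) \<in> A" using r by (auto simp: A_def)
    then show ?thesis using z(2) by fastforce
  next
    case False
    then show ?thesis using z(1) by (auto simp: A_def)
  qed
  moreover have "0 \<le> snd z" "Q \<subseteq> cball (fst z) (snd z)" using z(1) by (auto simp: A_def)
  ultimately show ?thesis unfolding is_MEB_def by blast
qed

text \<open>Compare with the balls centred on the segment from \<open>c\<close> to \<open>c'\<close>, close to \<open>c\<close>.\<close>

lemma is_MEB_dist_centers:
  fixes Q :: "'a::euclidean_space set"
  assumes ne: "Q \<noteq> {}" and M: "is_MEB Q c r" and sub: "Q \<subseteq> cball c' r'" and r': "0 \<le> r'"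
  shows "r\<^sup>2 + (dist c c')\<^sup>2 \<le> r'\<^sup>2"
proof -
  define K where "K = dist c c'"
  have r: "0 \<le> r" "Q \<subseteq> cball c r" using M by (auto simp: is_MEB_def)
  have *: "r\<^sup>2 + (1 - t) * K\<^sup>2 \<le> r'\<^sup>2" if t: "0 < t" "t < 1" for t
  proof -
    define ct where "ct = (1 - t) *\<^sub>R c + t *\<^sub>R c'"
    \<comment> \<open>\<open>b\<close> is Stewart's identity for a point of the segment, with the
      two distances replaced by the radii. Hence \<open>sqrt b\<close> is the radius of an enclosing
      ball about \<open>ct\<close>.\<close>
    define b where "b = (1 - t) * r\<^sup>2 + t * r'\<^sup>2 - t * (1 - t) * K\<^sup>2"
    have le: "(dist ct q)\<^sup>2 \<le> b" if "q \<in> Q" for q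
    proof -
      have "(dist ct q)\<^sup>2 = (1 - t) * (dist c q)\<^sup>2 + t * (dist c' q)\<^sup>2 - t * (1 - t) * K\<^sup>2"
        unfolding ct_def K_def dist_norm power2_norm_eq_inner
        by (simp add: inner_diff_left inner_diff_right inner_add_left inner_add_right
            inner_commute algebra_simps)
      moreover have "(dist c q)\<^sup>2 \<le> r\<^sup>2" "(dist c' q)\<^sup>2 \<le> r'\<^sup>2"
        using r sub that by (auto intro!: power_mono)
      then have "(1 - t) * (dist c q)\<^sup>2 \<le> (1 - t) * r\<^sup>2" "t * (dist c' q)\<^sup>2 \<le> t * r'\<^sup>2"
        using t by (auto intro: mult_left_mono)
      ultimately show ?thesis by (simp add: b_def)
    qed
    have "r\<^sup>2 \<le> b"
    proof -
      obtain q where "q \<in> Q" using ne by blast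
      then have "0 \<le> b" using le[of q] zero_le_power2[of "dist ct q"] by linarith
      moreover have "Q \<subseteq> cball ct (sqrt b)" using le real_le_rsqrt by fastforce
      ultimately have "r \<le> sqrt b" using M by (auto simp: is_MEB_def)
      then show ?thesis using r(1) \<open>0 \<le> b\<close> power_mono[of r "sqrt b" 2] by simp
    qed
    then have "t * (r\<^sup>2 + (1 - t) * K\<^sup>2) \<le> t * r'\<^sup>2" by (simp add: b_def algebra_simps)
    then show ?thesis using t by simp
  qed
  \<comment> \<open>Cancelling \<open>t\<close> required \<open>t > 0\<close> and left the factor
    \<open>1 - t\<close>; the limit from the right removes it.\<close>
  have "((\<lambda>t. r\<^sup>2 + (1 - t) * K\<^sup>2) \<longlongrightarrow> r\<^sup>2 + (1 - 0) * K\<^sup>2) (at_right 0)"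
    by (intro tendsto_intros)
  moreover have "\<forall>\<^sub>F t in at_right 0. r\<^sup>2 + (1 - t) * K\<^sup>2 \<le> r'\<^sup>2"
    unfolding eventually_at_right_field using * by (intro exI[of _ 1]) auto
  ultimately have "r\<^sup>2 + (1 - 0) * K\<^sup>2 \<le> r'\<^sup>2"
    by (rule tendsto_upperbound) simp
  then show ?thesis by (simp add: K_def)
qed

text \<open>Minimality in both directions equates the radii; \<open>is_MEB_dist_centers\<close> then
  forces the distance of the centres to be zero.\<close>

lemma is_MEB_unique:
  assumes "Q \<noteq> {}" "is_MEB Q c r" "is_MEB Q c' r'"
  shows "c = c'" "r = r'"
proof -
  show "r = r'" using assms(2,3) by (force simp: is_MEB_def intro: antisym)
  then show "c = c'"
    using is_MEB_dist_centers[OF assms(1,2), of c' r'] assms(3) by (simp add: is_MEB_def)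
qed

lemma is_MEB_meb:
  fixes Q :: "'a::euclidean_space set"
  assumes "bounded Q" "Q \<noteq> {}"
  shows "is_MEB Q (meb_center Q) (meb_radius Q)"
proof -
  obtain c r where cr: "is_MEB Q c r" using ex_is_MEB[OF assms] by blast
  have "meb_center Q = c"
    unfolding meb_center_def using cr is_MEB_unique(1)[OF assms(2)] by blast
  moreover have "meb_radius Q = r"
    unfolding meb_radius_def using cr is_MEB_unique(2)[OF assms(2)] by blast
  ultimately show ?thesis using cr by simp
qed

lemma meb_radius_nonneg:
  assumes "bounded Q" "Q \<noteq> {}"
  shows "0 \<le> meb_radius Q"
  using is_MEB_meb[OF assms] by (simp add: is_MEB_def)

lemma meb_radius_mono:
  assumes "bounded B" "A \<subseteq> B" "A \<noteq> {}"
  shows "meb_radius A \<le> meb_radius B"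
  using is_MEB_meb[of A] is_MEB_meb[of B] assms bounded_subset[OF assms(1,2)]
  unfolding is_MEB_def by blast

text \<open>The new ball contains \<open>p\<close>, so its centre has moved by more than
  \<open>\<rho> - r'\<close>. By \<open>is_MEB_dist_centers\<close> this shift costs radius, and
  \<open>r'\<^sup>2\<close> cancels when the square is expanded.\<close>

lemma meb_radius_insert_far:
  fixes A :: "'a::euclidean_space set"
  assumes "bounded A" "A \<noteq> {}" and far: "\<rho> < dist (meb_center A) p"
    and le: "meb_radius (insert p A) \<le> \<rho>"
  shows "(meb_radius A)\<^sup>2 + \<rho>\<^sup>2 < 2 * \<rho> * meb_radius (insert p A)"
proof -
  define c r c' r' where "c = meb_center A" and "r = meb_radius A"
    and "c' = meb_center (insert p A)" and "r' = meb_radius (insert p A)"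
  have M: "is_MEB A c r" and M': "is_MEB (insert p A) c' r'"
    using is_MEB_meb[of A] is_MEB_meb[of "insert p A"] assms(1,2)
    by (simp_all add: c_def r_def c'_def r'_def)
  have "r\<^sup>2 + (dist c c')\<^sup>2 \<le> r'\<^sup>2"
    using is_MEB_dist_centers[OF assms(2) M] M' by (auto simp: is_MEB_def)
  moreover have "dist c' p \<le> r'" using M' by (simp add: is_MEB_def)
  then have "\<rho> - r' < dist c c'"
    using far dist_triangle[of c p c'] by (simp add: c_def)
  \<comment> \<open>Squaring keeps the order because \<open>le\<close> makes
    \<open>\<rho> - r'\<close> nonnegative.\<close>
  then have "(\<rho> - r')\<^sup>2 < (dist c c')\<^sup>2"
    using le by (intro power_strict_mono) (auto simp: r'_def)
  ultimately have "r\<^sup>2 + \<rho>\<^sup>2 < 2 * \<rho> * r'"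
    by (simp add: power2_diff)
  then show ?thesis by (simp add: r_def r'_def)
qed

text \<open>Here \<open>i\<close> stands for the number of points so far. Inserting
  \<open>inv\<close> into \<open>meb_radius_insert_far\<close> gives
  \<open>r' > (i^2 + 1) / (i + 1)^2 * \<rho>\<close>, and this factor exceeds
  \<open>i / (i + 2)\<close>.\<close>

lemma meb_radius_growth:
  fixes A :: "'a::euclidean_space set"
  assumes "bounded A" "A \<noteq> {}" and far: "\<rho> < dist (meb_center A) p"
    and le: "meb_radius (insert p A) \<le> \<rho>"
    and i: "1 \<le> i" and inv: "(i - 1) * \<rho> \<le> (i + 1) * meb_radius A"
  shows "i * \<rho> < (i + 2) * meb_radius (insert p A)"
proof -
  define r r' where "r = meb_radius A" and "r' = meb_radius (insert p A)"
  have step: "r\<^sup>2 + \<rho>\<^sup>2 < 2 * \<rho> * r'"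
    using meb_radius_insert_far[OF assms(1-4)] by (simp add: r_def r'_def)
  have "0 \<le> r'" unfolding r'_def using assms(1) by (intro meb_radius_nonneg) auto
  then have "0 \<le> \<rho>" using le by (simp add: r'_def)
  moreover have "\<rho> \<noteq> 0" using step by auto
  ultimately have \<rho>: "0 < \<rho>" by simp
  have "((i - 1) * \<rho>)\<^sup>2 \<le> ((i + 1) * r)\<^sup>2"
    using inv i \<rho> by (intro power_mono) (auto simp: r_def)
  then have "(i - 1)\<^sup>2 * \<rho>\<^sup>2 + (i + 1)\<^sup>2 * \<rho>\<^sup>2 \<le> (i + 1)\<^sup>2 * (r\<^sup>2 + \<rho>\<^sup>2)"
    by (simp add: power_mult_distrib distrib_left)
  also have "\<dots> < (i + 1)\<^sup>2 * (2 * \<rho> * r')"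
    using step i by (intro mult_strict_left_mono) auto
  finally have "(2 * \<rho>) * ((i\<^sup>2 + 1) * \<rho>) < (2 * \<rho>) * ((i + 1)\<^sup>2 * r')"
    by (simp add: power2_eq_square algebra_simps)
  then have "(i\<^sup>2 + 1) * \<rho> < (i + 1)\<^sup>2 * r'" using \<rho> by simp
  then have "(i + 2) * ((i\<^sup>2 + 1) * \<rho>) < (i + 2) * ((i + 1)\<^sup>2 * r')"
    using i by (intro mult_strict_left_mono) auto
  \<comment> \<open>The two cubics in \<open>i\<close> differ only by the constant 2.\<close>
  moreover have "(i + 1)\<^sup>2 * (i * \<rho>) = (i + 2) * ((i\<^sup>2 + 1) * \<rho>) - 2 * \<rho>"
    by (simp add: power2_eq_square algebra_simps)
  ultimately have "(i + 1)\<^sup>2 * (i * \<rho>) < (i + 1)\<^sup>2 * ((i + 2) * r')"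
    using \<rho> by (simp add: mult.left_commute)
  then show ?thesis using i by (simp add: r'_def)
qed

section \<open>Farthest points\<close>

text \<open>If one point of \<open>Q\<close> lay in the ball, all of \<open>P - Q\<close> would too,
  since those points are no farther from \<open>c\<close>. That is more points than the ball
  contains.\<close>

lemma farthest_outside_cball:
  assumes "finite P" "is_farthest P k c Q" "card (P \<inter> cball c \<rho>) < card P - k" "x \<in> Q"
  shows "\<rho> < dist c x"
proof (rule ccontr)
  assume "\<not> \<rho> < dist c x"
  moreover have "dist c y \<le> dist c x" if "y \<in> P - Q" for y
    using assms(2,4) that by (auto simp: is_farthest_def)
  ultimately have "P - Q \<subseteq> P \<inter> cball c \<rho>" by force
  then have "card (P - Q) \<le> card (P \<inter> cball c \<rho>)"
    using assms(1) by (intro card_mono) auto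
  moreover have "card (P - Q) = card P - k"
    using assms(1,2) by (auto simp: is_farthest_def card_Diff_subset finite_subset)
  ultimately show False using assms(3) by simp
qed

section \<open>Random lists and trees\<close>

text \<open>The marginal law of one entry. It allows the analysis to follow a single child subtree
  while all siblings grow as well.\<close>

lemma map_pmf_nth_indep_list_pmf:
  "i < length ps \<Longrightarrow> map_pmf (\<lambda>xs. xs ! i) (indep_list_pmf ps) = ps ! i"
proof (induction ps arbitrary: i)
  case (Cons p ps)
  then show ?case
    by (cases i) (simp_all add: map_bind_pmf map_pmf_def[symmetric] map_pmf_comp bind_return_pmf')
qed simp

lemma length_indep_list_pmf:
  "xs \<in> set_pmf (indep_list_pmf ps) \<Longrightarrow> length xs = length ps"
  by (induction ps arbitrary: xs) auto

lemma prob_replicate_pmf_disjnt: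
  "measure_pmf.prob (replicate_pmf s p) {S. set S \<inter> A = {}} = (1 - measure_pmf.prob p A) ^ s"
proof (induction s)
  case (Suc s)
  let ?D = "{S. set S \<inter> A = {}}"
  have "replicate_pmf (Suc s) p = bind_pmf p (\<lambda>x. map_pmf ((#) x) (replicate_pmf s p))"
    by (simp add: map_pmf_def)
  then have "emeasure (replicate_pmf (Suc s) p) ?D =
      (\<integral>\<^sup>+x. emeasure (replicate_pmf s p) ((#) x -` ?D) \<partial>p)"
    by (simp add: emeasure_bind_pmf)
  \<comment> \<open>If \<open>x\<close> is in \<open>A\<close>, the preimage is empty; otherwise it
    is the miss event for the remaining draws.\<close>
  also have "\<dots> = (\<integral>\<^sup>+x. emeasure (replicate_pmf s p) ?D * indicator (- A) x \<partial>p)"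
    by (intro nn_integral_cong) (auto simp: vimage_def indicator_def)
  also have "\<dots> = emeasure (replicate_pmf s p) ?D * emeasure p (- A)"
    by (simp add: nn_integral_cmult_indicator)
  finally have "measure_pmf.prob (replicate_pmf (Suc s) p) ?D =
      measure_pmf.prob (replicate_pmf s p) ?D * measure_pmf.prob p (- A)"
    by (simp add: measure_def enn2real_mult)
  moreover have "measure_pmf.prob p (- A) = 1 - measure_pmf.prob p A"
    using measure_pmf.prob_compl[of A p] by (simp add: Compl_eq_Diff_UNIV)
  ultimately show ?case using Suc by (simp add: mult.commute)
qed simp

text \<open>Total probability, keeping only first-stage outcomes in \<open>A\<close>. It chains the
  bounds for the root draw and for the successive samples.\<close>

lemma prob_bind_pmf_ge:
  assumes "0 \<le> b" and "\<And>x. x \<in> A \<Longrightarrow> x \<in> set_pmf p \<Longrightarrow> b \<le> measure_pmf.prob (f x) E"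
  shows "measure_pmf.prob p A * b \<le> measure_pmf.prob (bind_pmf p f) E"
proof -
  have "ennreal (measure_pmf.prob p A * b) = (\<integral>\<^sup>+x. ennreal b * indicator A x \<partial>measure_pmf p)"
    using assms(1) by (simp add: nn_integral_cmult_indicator measure_pmf.emeasure_eq_measure ennreal_mult mult.commute)
  also have "\<dots> \<le> (\<integral>\<^sup>+x. ennreal (measure_pmf.prob (f x) E) \<partial>measure_pmf p)"
    by (intro nn_integral_mono_AE) (auto simp: AE_measure_pmf_iff indicator_def assms(2))
  also have "\<dots> = ennreal (measure_pmf.prob (bind_pmf p f) E)"
    by (simp add: emeasure_bind_pmf measure_pmf.emeasure_eq_measure[symmetric])
  finally show ?thesis by simp
qed

lemma grow_tree_root:
  "T \<in> set_pmf (grow_tree far s m a xs) \<Longrightarrow> [last xs] \<in> node_paths T"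
  by (cases m) auto

text \<open>\<open>I\<close> is an invariant of the path being followed. Either the current path is
  already good, or with probability at least \<open>1 - (1 - q) ^ s\<close> some child preserves
  \<open>I\<close> and the induction continues there; \<open>m\<close> levels give \<open>m\<close>
  factors. Paths in the subtree start at \<open>last xs\<close>, so prefixing
  \<open>butlast xs\<close> restores the path from the root.\<close>

lemma prob_grow_tree_ge:
  assumes q: "0 \<le> q" "q \<le> 1"
    and step: "\<And>a xs. I xs \<Longrightarrow> \<not> good xs \<Longrightarrow> q \<le> measure_pmf.prob (pmf_of_set (far a xs)) {x. I (xs @ [x])}"
    and leaf: "\<And>xs. I xs \<Longrightarrow> length xs = h \<Longrightarrow> good xs"
    and "I xs" "xs \<noteq> []" "length xs + m = h"
  shows "(1 - (1 - q) ^ s) ^ m \<le>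
    measure_pmf.prob (grow_tree far s m a xs) {T. \<exists>ys\<in>node_paths T. good (butlast xs @ ys)}"
  using assms(5-7)
proof (induction m arbitrary: a xs)
  case 0
  then have "good xs" using leaf by simp
  then show ?case using 0 by (simp add: indicator_def)
next
  case (Suc m)
  let ?u = "1 - (1 - q) ^ s"
  let ?E = "\<lambda>xs. {T. \<exists>ys\<in>node_paths T. good (butlast xs @ ys)}"
  have u: "0 \<le> ?u" "?u \<le> 1" using q by (auto simp: power_le_one)
  show ?case
  proof (cases "good xs")
    case True
    \<comment> \<open>The root of the subtree is itself a witness:
      \<open>butlast xs @ [last xs] = xs\<close>.\<close>
    have "AE T in grow_tree far s (Suc m) a xs. T \<in> ?E xs"
      unfolding AE_measure_pmf_iff using True Suc.prems(2) grow_tree_root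
      by (fastforce intro: bexI[of _ "[last xs]"])
    then have "measure_pmf.prob (grow_tree far s (Suc m) a xs) (?E xs) = 1"
      by (intro measure_pmf.prob_eq_1[THEN iffD2]) auto
    moreover have "?u ^ Suc m \<le> 1" using u by (intro power_le_one)
    ultimately show ?thesis by simp
  next
    case False
    define p where "p = pmf_of_set (far a xs)"
    define A where "A = {x. I (xs @ [x])}"
    define f where "f S = map_pmf (RNode (last xs)) (indep_list_pmf
        (map (\<lambda>i. grow_tree far s m (a @ [i]) (xs @ [S ! i])) [0..<length S]))" for S
    have "1 - measure_pmf.prob p A \<le> 1 - q"
      using step[OF Suc.prems(1) False, of a] by (simp add: p_def A_def)
    then have "(1 - measure_pmf.prob p A) ^ s \<le> (1 - q) ^ s"
      by (intro power_mono) auto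
    then have "?u \<le> 1 - measure_pmf.prob (replicate_pmf s p) {S. set S \<inter> A = {}}"
      by (simp add: prob_replicate_pmf_disjnt)
    also have "\<dots> = measure_pmf.prob (replicate_pmf s p) {S. set S \<inter> A \<noteq> {}}"
      using measure_pmf.prob_compl[of "{S. set S \<inter> A = {}}" "replicate_pmf s p"]
      by (simp add: set_diff_eq)
    finally have "?u * ?u ^ m \<le> measure_pmf.prob (replicate_pmf s p) {S. set S \<inter> A \<noteq> {}} * ?u ^ m"
      using u by (intro mult_right_mono) auto
    also have "\<dots> \<le> measure_pmf.prob (bind_pmf (replicate_pmf s p) f) (?E xs)"
    proof (intro prob_bind_pmf_ge)
      fix S assume "S \<in> {S. set S \<inter> A \<noteq> {}}"
      then obtain i where i: "i < length S" "I (xs @ [S ! i])"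
        by (auto simp: A_def in_set_conv_nth)
      let ?L = "map (\<lambda>i. grow_tree far s m (a @ [i]) (xs @ [S ! i])) [0..<length S]"
      have "?u ^ m \<le> measure_pmf.prob (?L ! i) (?E (xs @ [S ! i]))"
        using Suc.IH[OF i(2)] Suc.prems(3) i(1) by simp
      \<comment> \<open>Only the subtree of the child that preserves \<open>I\<close> is examined;
        its law is a marginal of the joint law of all child subtrees.\<close>
      also have "?L ! i = map_pmf (\<lambda>ts. ts ! i) (indep_list_pmf ?L)"
        using i(1) by (subst map_pmf_nth_indep_list_pmf) auto
      also have "measure_pmf.prob \<dots> (?E (xs @ [S ! i])) \<le> measure_pmf.prob (f S) (?E xs)"
        unfolding f_def measure_map_pmf
      proof (intro measure_pmf.finite_measure_mono_AE AE_pmfI impI)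
        fix ts assume ts: "ts \<in> set_pmf (indep_list_pmf ?L)"
          and "ts \<in> (\<lambda>ts. ts ! i) -` ?E (xs @ [S ! i])"
        then obtain ys where ys: "ys \<in> node_paths (ts ! i)" "good (xs @ ys)" by auto
        have "i < length ts" using length_indep_list_pmf[OF ts] i(1) by simp
        then have "last xs # ys \<in> node_paths (RNode (last xs) ts)"
          using ys(1) by (auto intro!: imageI bexI[of _ "ts ! i"])
        moreover have "butlast xs @ last xs # ys = xs @ ys"
          using Suc.prems(2) by (metis append_butlast_last_id append_Cons append_Nil append_assoc)
        ultimately show "ts \<in> RNode (last xs) -` ?E xs"
          using ys(2) by (metis (mono_tags, lifting) mem_Collect_eq vimageI)
      qed simp
      finally show "?u ^ m \<le> measure_pmf.prob (f S) (?E xs)" .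
    qed (use u in simp)
    also have "bind_pmf (replicate_pmf s p) f = grow_tree far s (Suc m) a xs"
      by (simp add: p_def f_def[abs_def] map_pmf_def)
    finally show ?thesis by simp
  qed
qed

section \<open>The probability of success\<close>

text \<open>The factor \<open>1 + 1 / \<delta>\<close> is the reciprocal of the hit probability
  \<open>?q\<close>, so \<open>?q\<close> times the sample size is at least
  \<open>ln (h / \<mu>)\<close>; then \<open>1 - ?q \<le> exp (- ?q)\<close>.\<close>

lemma sample_size_miss_le:
  assumes "0 < \<delta>" "0 < \<mu>" "0 < h"
  shows "(1 - \<delta> / (1 + \<delta>)) ^ sample_size \<delta> \<mu> h \<le> \<mu> / real h"
proof -
  let ?q = "\<delta> / (1 + \<delta>)" and ?s = "sample_size \<delta> \<mu> h"
  have "(1 + 1 / \<delta>) * ln (real h / \<mu>) \<le> real ?s"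
    unfolding sample_size_def by (rule real_nat_ceiling_ge)
  then have "?q * ((1 + 1 / \<delta>) * ln (real h / \<mu>)) \<le> ?q * real ?s"
    using assms(1) by (intro mult_left_mono) auto
  moreover have "?q * (1 + 1 / \<delta>) = 1" using assms(1) by (simp add: divide_simps)
  ultimately have s: "ln (real h / \<mu>) \<le> ?q * real ?s"
    by (metis mult.assoc mult_1)
  have "1 - ?q \<le> exp (- ?q)" using exp_ge_add_one_self[of "- ?q"] by simp
  then have "(1 - ?q) ^ ?s \<le> exp (- ?q) ^ ?s"
    using assms(1) by (intro power_mono) auto
  also have "\<dots> = exp (- (?q * real ?s))" by (simp add: exp_of_nat_mult[symmetric] mult.commute)
  also have "\<dots> \<le> exp (- ln (real h / \<mu>))" using s by simp
  also have "\<dots> = \<mu> / real h" using assms by (simp add: exp_minus)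
  finally show ?thesis .
qed

text \<open>Bernoulli's inequality with exponent \<open>h\<close>, followed by dropping one factor
  from the unit interval. The exponent \<open>h - 1\<close> counts the levels that draw
  samples.\<close>

lemma one_minus_div_power_ge:
  fixes \<mu> :: real
  assumes "0 \<le> \<mu>" "\<mu> \<le> 1"
  shows "1 - \<mu> \<le> (1 - \<mu> / real h) ^ (h - 1)"
proof (cases "h = 0")
  case False
  then have h: "\<mu> / real h \<le> 1" "0 \<le> \<mu> / real h"
    using assms by (auto simp: divide_le_eq)
  have "1 - \<mu> = 1 + real h * (- (\<mu> / real h))" using False by simp
  also have "\<dots> \<le> (1 + - (\<mu> / real h)) ^ h" using h by (intro Bernoulli_inequality) simp
  also have "\<dots> \<le> (1 - \<mu> / real h) ^ (h - 1)" using h by (simp add: power_decreasing)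
  finally show ?thesis .
\<comment> \<open>For \<open>h = 0\<close> truncated subtraction makes the exponent 0 and the right
  side 1.\<close>
qed (use assms in simp)

theorem theorem1:
  fixes P P_opt :: "(real ^ 'd) set"
    and \<gamma> \<epsilon> \<delta> \<mu> :: real
    and n k h :: nat
    and far :: "nat list \<Rightarrow> (real ^ 'd) list \<Rightarrow> (real ^ 'd) set"
  assumes "finite P" and "P \<noteq> {}" and "card P = n"
    and "0 < \<gamma>" and "\<gamma> < 1"
    and "0 < \<epsilon>" and "\<epsilon> < 1"
    and "0 < \<delta>" and "\<delta> < 1"
    and "0 < \<mu>" and "\<mu> < 1"
    and "real k = (1 + \<delta>) * \<gamma> * real n" and "(1 + \<delta>) * \<gamma> < 1"
    and "h = nat \<lceil>2 / \<epsilon>\<rceil> + 1"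
    and "is_outlier_opt P \<gamma> P_opt"
    and "\<And>a xs. xs \<noteq> [] \<Longrightarrow> set xs \<subseteq> P \<Longrightarrow>
           is_farthest P k (meb_center (set xs)) (far a xs)"
  shows "measure_pmf.prob (random_tree P far \<delta> \<mu> h)
           {T. \<exists>xs\<in>node_paths T.
                 yields_approx P \<gamma> (meb_radius P_opt) \<epsilon> \<delta> (meb_center (set xs))}
         \<ge> (1 - \<mu>) * (1 - \<gamma>)"
proof -
  define R \<rho> where "R = meb_radius P_opt" and "\<rho> = (1 + \<epsilon>) * R"
  define good where "good xs = yields_approx P \<gamma> R \<epsilon> \<delta> (meb_center (set xs))" for xs
  define I where "I xs \<longleftrightarrow> xs \<noteq> [] \<and> set xs \<subseteq> P_opt \<and>
      (real (length xs) - 1) * \<rho> \<le> (real (length xs) + 1) * meb_radius (set xs)" for xs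
  define q where "q = \<delta> / (1 + \<delta>)"
  define s where "s = sample_size \<delta> \<mu> h"
  have opt: "P_opt \<subseteq> P" "(1 - \<gamma>) * n \<le> card P_opt"
    using assms(3,15) by (auto simp: is_outlier_opt_def)
  have n: "0 < n" using assms(1-3) by (simp add: card_gt_0_iff flip: assms(3))
  have "0 < (1 - \<gamma>) * n" using n assms(5) by simp
  then have "P_opt \<noteq> {}" using opt(2) by auto
  have bdd: "bounded P_opt" using opt(1) assms(1) by (meson finite_imp_bounded finite_subset)
  have R: "0 \<le> R" unfolding R_def using bdd \<open>P_opt \<noteq> {}\<close> by (rule meb_radius_nonneg)
  have \<rho>: "R \<le> \<rho>" "0 \<le> \<rho>" using R assms(6) by (auto simp: \<rho>_def distrib_right)
  \<comment> \<open>At most \<open>\<gamma> * n\<close> points of \<open>P\<close> lie outside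
    \<open>P_opt\<close>, which leaves at least
    \<open>k - \<gamma> * n = \<delta> * \<gamma> * n\<close> optimal points among the
    \<open>k\<close> farthest.\<close>
  have far_hit: "\<delta> * \<gamma> * n \<le> card (far a xs \<inter> P_opt)" if "I xs" for a xs
  proof -
    have F: "is_farthest P k (meb_center (set xs)) (far a xs)"
      using that opt(1) by (intro assms(16)) (auto simp: I_def)
    then have fin: "finite (far a xs)" using assms(1) by (auto simp: is_farthest_def finite_subset)
    have "card (far a xs - P_opt) \<le> card (P - P_opt)"
      using F assms(1) by (intro card_mono) (auto simp: is_farthest_def)
    also have "\<dots> = n - card P_opt" using opt(1) assms(1,3) by (simp add: card_Diff_subset finite_subset)
    finally have "card (far a xs - P_opt) + card P_opt \<le> n"
      using card_mono[OF assms(1) opt(1)] assms(3) by simp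
    moreover have "card (far a xs \<inter> P_opt) + card (far a xs - P_opt) = k"
      using F card_Int_Diff[OF fin, of P_opt] by (simp add: is_farthest_def)
    ultimately show ?thesis using opt(2) assms(12) by (simp add: algebra_simps)
  qed
  \<comment> \<open>The strict bound is recorded next to \<open>I\<close>, whose own bound is weak,
    because the contradiction at the leaves needs strictness.\<close>
  have extend: "\<rho> * length xs < (length xs + 2) * meb_radius (set (xs @ [p])) \<and> I (xs @ [p])"
    if xs: "I xs" "\<not> good xs" and p: "p \<in> far a xs" "p \<in> P_opt" for a xs p
  proof -
    have sub: "insert p (set xs) \<subseteq> P_opt" using xs(1) p(2) by (simp add: I_def)
    \<comment> \<open>The radius \<open>\<rho>\<close> is the largest one that
      \<open>yields_approx\<close> admits; as \<open>good xs\<close> fails, its ball covers too few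
      points.\<close>
    have "real (card (P \<inter> cball (meb_center (set xs)) \<rho>)) < (1 - (1 + \<delta>) * \<gamma>) * n"
      using xs(2) \<rho> assms(3) by (force simp: good_def yields_approx_def \<rho>_def)
    also have "\<dots> = real n - real k" using assms(12) by (simp add: algebra_simps)
    finally have "card (P \<inter> cball (meb_center (set xs)) \<rho>) < card P - k"
      using assms(3) by linarith
    moreover have "is_farthest P k (meb_center (set xs)) (far a xs)"
      using xs(1) opt(1) by (intro assms(16)) (auto simp: I_def)
    ultimately have "\<rho> < dist (meb_center (set xs)) p"
      using farthest_outside_cball[OF assms(1)] p(1) by blast
    moreover have "meb_radius (insert p (set xs)) \<le> \<rho>"
      using meb_radius_mono[OF bdd sub] \<rho>(1) by (simp add: R_def)
    moreover have "1 \<le> real (length xs)" using xs(1) by (cases xs) (auto simp: I_def)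
    ultimately have "length xs * \<rho> < (real (length xs) + 2) * meb_radius (insert p (set xs))"
      using xs(1) by (intro meb_radius_growth) (auto simp: I_def)
    then show ?thesis using sub by (simp add: I_def algebra_simps)
  qed
  have prob_I: "q \<le> measure_pmf.prob (pmf_of_set (far a xs)) {x. I (xs @ [x])}"
    if xs: "I xs" "\<not> good xs" for a xs
  proof -
    have F: "is_farthest P k (meb_center (set xs)) (far a xs)"
      using xs opt(1) by (intro assms(16)) (auto simp: I_def)
    \<comment> \<open>Positivity of \<open>k\<close> makes the farthest set nonempty, so that
      \<open>pmf_of_set\<close> is the uniform law on it.\<close>
    have k: "0 < real k" using assms(4,8,12) n by simp
    then have fin: "finite (far a xs)" "far a xs \<noteq> {}"
      using F assms(1) by (auto simp: is_farthest_def finite_subset)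
    have "q = \<delta> * \<gamma> * n / k" using assms(4,8) n unfolding assms(12) q_def by simp
    also have "\<dots> \<le> card (far a xs \<inter> P_opt) / k"
      using far_hit[OF xs(1)] k by (intro divide_right_mono) auto
    also have "\<dots> = measure_pmf.prob (pmf_of_set (far a xs)) P_opt"
      using F fin by (simp add: measure_pmf_of_set is_farthest_def)
    also have "\<dots> \<le> measure_pmf.prob (pmf_of_set (far a xs)) {x. I (xs @ [x])}"
      using extend[OF xs, of _ a] fin
      by (intro measure_pmf.finite_measure_mono_AE AE_pmfI) auto
    finally show ?thesis .
  qed
  have leaf: "good xs" if xs: "I xs" "length xs = h" for xs
  proof (rule ccontr)
    assume "\<not> good xs"
    \<comment> \<open>Leaves are not sampled from, but the nonempty intersection \<open>P\<^sub>v \<inter> P_opt\<close> still yields one more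
      point; this makes the final inequality strict even when \<open>2 / \<epsilon>\<close> is an integer.\<close>
    have "0 < \<delta> * \<gamma> * n" using assms(4,8) n by simp
    then have "far [] xs \<inter> P_opt \<noteq> {}" using far_hit[OF xs(1), of "[]"] by auto
    then obtain p where p: "p \<in> far [] xs" "p \<in> P_opt" by blast
    have "set (xs @ [p]) \<subseteq> P_opt" using xs(1) p by (auto simp: I_def)
    then have "meb_radius (set (xs @ [p])) \<le> R"
      unfolding R_def using bdd by (intro meb_radius_mono) auto
    then have "(real h + 2) * meb_radius (set (xs @ [p])) \<le> (real h + 2) * R"
      by (intro mult_left_mono) auto
    \<comment> \<open>With \<open>\<rho> = (1 + \<epsilon>) * R\<close>, the term
      \<open>h * R\<close> cancels from \<open>h * \<rho> < (h + 2) * R\<close>.\<close>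
    then have "real h * \<epsilon> * R < 2 * R"
      using extend[OF xs(1) \<open>\<not> good xs\<close> p] xs(2) by (simp add: \<rho>_def algebra_simps)
    moreover have "2 / \<epsilon> \<le> real h"
      unfolding assms(14) using real_nat_ceiling_ge[of "2 / \<epsilon>"] by simp
    then have "2 * R \<le> real h * \<epsilon> * R"
      using R assms(6) by (intro mult_right_mono) (auto simp: divide_le_eq)
    ultimately show False by simp
  qed
  have h: "0 < h" using assms(14) by simp
  have "1 - \<mu> \<le> (1 - \<mu> / h) ^ (h - 1)" using assms(10,11) by (intro one_minus_div_power_ge) auto
  also have "\<dots> \<le> (1 - (1 - q) ^ s) ^ (h - 1)"
    unfolding q_def s_def using sample_size_miss_le[of \<delta> \<mu> h] assms(8,10,11) h
    by (intro power_mono) (auto simp: divide_le_eq)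
  finally have u: "1 - \<mu> \<le> (1 - (1 - q) ^ s) ^ (h - 1)" .
  \<comment> \<open>The factor \<open>1 - \<gamma>\<close> pays for the root being an optimal
    point.\<close>
  have "1 - \<gamma> \<le> card P_opt / n" using opt(2) n by (simp add: field_simps)
  also have "\<dots> = measure_pmf.prob (pmf_of_set P) P_opt"
    using opt(1) assms(1-3) by (simp add: measure_pmf_of_set Int_absorb1)
  finally have "(1 - \<mu>) * (1 - \<gamma>) \<le> measure_pmf.prob (pmf_of_set P) P_opt * (1 - \<mu>)"
    using assms(11) by (simp add: mult.commute mult_left_mono)
  also have "\<dots> \<le> measure_pmf.prob (random_tree P far \<delta> \<mu> h) {T. \<exists>xs\<in>node_paths T. good xs}"
    unfolding random_tree_def s_def[symmetric]
  proof (intro prob_bind_pmf_ge)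
    fix r assume "r \<in> P_opt"
    \<comment> \<open>For a one-point path the factor \<open>length xs - 1\<close> vanishes, so the
      radius bound only asks for nonnegativity.\<close>
    then have "I [r]" using meb_radius_nonneg[of "{r}"] by (simp add: I_def)
    have "(1 - (1 - q) ^ s) ^ (h - 1) \<le> measure_pmf.prob (grow_tree far s (h - 1) [] [r])
        {T. \<exists>ys\<in>node_paths T. good (butlast [r] @ ys)}"
      using assms(8) h \<open>I [r]\<close> prob_I leaf
      by (intro prob_grow_tree_ge[where I = I and h = h]) (auto simp: q_def)
    then show "1 - \<mu> \<le> measure_pmf.prob (grow_tree far s (h - 1) [] [r])
        {T. \<exists>xs\<in>node_paths T. good xs}"
      using u by simp
  qed (use assms(11) in simp)
  finally show ?thesis by (simp add: good_def R_def)
qed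

end
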